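(* Let $h_\alpha(y)=y^\alpha$ with $\alpha>1$ (and $h_1(y)=y$, $\alpha_0=1$), applied to $F_X$ (likelihood distortion only). Assume that for $\Pi$-almost every $\theta$ the maps $\alpha\mapsto\log h'_\alpha(F_X(x_i|\theta))$, $i=1,\dots,n$, are differentiable at $\alpha_0=1$. Let $\delta_0>0$, let $g:\Theta\to\mathbb{R}^s$ be measurable, and assume that for some $G\in L^1(\Pi)$, $\left|\delta^{-1}g(\theta)(\mathcal{L}_{h_{1+\delta}}(\theta)-\mathcal{L}_{h_1}(\theta))\right|\le G(\theta)$ for all admissible $|\delta|\le\delta_0$ and $\Pi$-almost every $\theta$. Then the Bayesian local sensitivity $\delta_n^{h_\alpha}=\frac{\partial}{\partial\alpha}\mathrm{E}_{\Pi^n_{h_\alpha}}[g(\vartheta)]\big|_{\alpha=1}$ satisfies $$\delta_n^{h_\alpha}=\mathrm{Cov}_{\Pi^n}\Big[g(\vartheta),\ \sum_{i=1}^n\log F_X(x_i|\vartheta)\Big].$$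
   Context: Setting: $\Theta\subseteq\mathbb{R}^k$ is the parameter space with prior probability distribution $\Pi$; $\vartheta$ is the random parameter with law $\Pi$. Given $\theta\in\Theta$, $X$ is an $\mathbb{R}^d$-valued random vector with distribution function $F_X(\cdot|\theta)$ and density $f_X(\cdot|\theta)$. The sample $x_{1:n}=(x_1,\dots,x_n)$ is a fixed realisation of an i.i.d. sample of $X$. The likelihood is $\mathcal{L}(\theta)=\prod_{i=1}^n f_X(x_i|\theta)$, and $\Pi^n$ is the posterior, $d\Pi^n(\theta)=\mathcal{L}(\theta)d\Pi(\theta)/\int_\Theta\mathcal{L}\,d\Pi$ (Bayes' rule is assumed to be well defined). For a distortion function $h$ (differentiable, non-decreasing $[0,1]\to[0,1]$ with $h(0)=0,h(1)=1$), the $h$-distorted likelihood is $\mathcal{L}_h(\theta)=\prod_{i=1}^n f_X(x_i|\theta)\,h'(F_X(x_i|\theta))$, and the distorted posterior is $\Pi^n_h(B)=\int_B\mathcal{L}_h\,d\Pi/\int_\Theta\mathcal{L}_h\,d\Pi$. In $h'_\alpha$ the prime is the derivative in $y$. Since $\alpha_0=1$ is the endpoint of the parameter range $\alpha\ge1$, derivatives in $\alpha$ at $\alpha_0=1$ are right derivatives, and $\delta$ is admissible if $\delta>0$ (so that $1+\delta$ is in the range). $\mathrm{Cov}_{\Pi^n}[g(\vartheta),T(\vartheta)]$ for $g$ valued in $\mathbb{R}^s$ and $T$ real-valued is the vector in $\mathbb{R}^s$ of covariances of the components of $g(\vartheta)$ with $T(\vartheta)$, for $\vartheta\sim\Pi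^n$.
   Formalization: It is additionally assumed that the sum of log F_X(x_i|θ) is integrable under the posterior Π^n, so that the covariance is defined; the domination condition does not imply this, and without it the sensitivity can be infinite. *)

theory Defs
  imports "HOL-Probability.Probability"
begin

section \<open>Distortion functions\<close>

text \<open>
  A distortion function lives on the unit interval, so its derivative at the endpoints is one-sided:
  all derivatives are taken within \<open>{0..1}\<close>. The values of \<open>h\<close> outside \<open>{0..1}\<close> are irrelevant.
\<close>

definition distortion_function :: "(real \<Rightarrow> real) \<Rightarrow> bool" where
  "distortion_function h \<longleftrightarrow>
     h ` {0..1} \<subseteq> {0..1} \<and> h differentiable_on {0..1} \<and> mono_on {0..1} h \<and> h 0 = 0 \<and> h 1 = 1"

definition distortion_deriv :: "(real \<Rightarrow> real) \<Rightarrow> real \<Rightarrow> real" where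
  "distortion_deriv h y = vector_derivative h (at y within {0..1})"

definition power_distortion :: "real \<Rightarrow> real \<Rightarrow> real" where
  "power_distortion \<alpha> y = y powr \<alpha>"

lemma power_distortion_has_deriv:
  assumes \<alpha>: "1 \<le> \<alpha>" and y: "y \<in> {0..1}"
  shows "(power_distortion \<alpha> has_real_derivative
           (if y = 0 then (if \<alpha> = 1 then 1 else 0) else \<alpha> * y powr (\<alpha> - 1))) (at y within {0..1})"
proof (cases "y = 0")
  case False
  then have "y > 0" using y by auto
  then have "((\<lambda>z. z powr \<alpha>) has_real_derivative \<alpha> * y powr (\<alpha> - 1)) (at y)"
    by (rule has_real_derivative_powr)
  then show ?thesis
    using False unfolding power_distortion_def by (auto intro: has_field_derivative_at_within)
next
  case True
  have "((\<lambda>z. z powr (\<alpha> - 1)) \<longlongrightarrow> (if \<alpha> = 1 then 1 else 0)) (at 0 within {0..1})"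
  proof (cases "\<alpha> = 1")
    case True
    have "eventually (\<lambda>z::real. z powr 0 = 1) (at 0 within {0..1})"
      by (auto simp: eventually_at_filter)
    then have "((\<lambda>z::real. z powr 0) \<longlongrightarrow> 1) (at 0 within {0..1})"
      by (rule tendsto_eventually)
    then show ?thesis using True by simp
  next
    case False
    have "((\<lambda>z::real. z powr (\<alpha> - 1)) \<longlongrightarrow> 0 powr (\<alpha> - 1)) (at 0 within {0..1})"
      using False \<alpha> by (intro tendsto_powr' tendsto_intros) (auto simp: eventually_at_filter)
    then show ?thesis using False by simp
  qed
  moreover have "eventually (\<lambda>z. z powr (\<alpha> - 1) = (z powr \<alpha> - 0 powr \<alpha>) / (z - 0)) (at 0 within {0..1})"
    by (auto simp: eventually_at_filter powr_diff)
  ultimately show ?thesis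
    using True by (auto simp: power_distortion_def has_field_derivative_iff elim: Lim_transform_eventually)
qed

lemma distortion_function_power:
  assumes "1 \<le> \<alpha>"
  shows "distortion_function (power_distortion \<alpha>)"
proof -
  have "power_distortion \<alpha> differentiable_on {0..1}"
    unfolding differentiable_on_def
    using power_distortion_has_deriv[OF assms] real_differentiable_def by blast
  then show ?thesis
    using assms
    by (auto simp: distortion_function_def power_distortion_def powr_le1 intro!: mono_onI powr_mono2)
qed

section \<open>Model, likelihood and posterior\<close>

text \<open>
  \<open>f \<theta>\<close> is the Lebesgue density of \<open>X\<close> given \<open>\<theta>\<close>. The order on \<open>real ^ 'd\<close> is componentwise,
  so \<open>cond_cdf f \<theta> x\<close> is the probability that \<open>X $ j \<le> x $ j\<close> for every \<open>j\<close>.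
\<close>

definition cond_law :: "('p \<Rightarrow> real ^ 'd \<Rightarrow> real) \<Rightarrow> 'p \<Rightarrow> (real ^ 'd) measure" where
  "cond_law f \<theta> = density lborel (\<lambda>y. ennreal (f \<theta> y))"

definition cond_cdf :: "('p \<Rightarrow> real ^ 'd \<Rightarrow> real) \<Rightarrow> 'p \<Rightarrow> real ^ 'd \<Rightarrow> real" where
  "cond_cdf f \<theta> x = measure (cond_law f \<theta>) {..x}"

definition bayes_model ::
    "(real ^ 'k) set \<Rightarrow> (real ^ 'k) measure \<Rightarrow> (real ^ 'k \<Rightarrow> real ^ 'd \<Rightarrow> real) \<Rightarrow> bool" where
  "bayes_model \<Theta> prior f \<longleftrightarrow>
     prob_space prior \<and> sets prior = sets (restrict_space borel \<Theta>) \<and>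
     (\<lambda>(\<theta>, y). f \<theta> y) \<in> borel_measurable (prior \<Otimes>\<^sub>M lborel) \<and>
     (\<forall>\<theta>\<in>\<Theta>. (\<forall>y. 0 \<le> f \<theta> y) \<and> prob_space (cond_law f \<theta>))"

text \<open>The sample consists of \<open>x 1, \<dots>, x n\<close>; other values of \<open>x\<close> are not used.\<close>

definition likelihood ::
    "('p \<Rightarrow> real ^ 'd \<Rightarrow> real) \<Rightarrow> nat \<Rightarrow> (nat \<Rightarrow> real ^ 'd) \<Rightarrow> 'p \<Rightarrow> real" where
  "likelihood f n x \<theta> = (\<Prod>i=1..n. f \<theta> (x i))"

definition distorted_likelihood ::
    "(real \<Rightarrow> real) \<Rightarrow> ('p \<Rightarrow> real ^ 'd \<Rightarrow> real) \<Rightarrow> nat \<Rightarrow> (nat \<Rightarrow> real ^ 'd) \<Rightarrow> 'p \<Rightarrow> real" where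
  "distorted_likelihood h f n x \<theta> =
     (\<Prod>i=1..n. f \<theta> (x i) * distortion_deriv h (cond_cdf f \<theta> (x i)))"

definition posterior_of :: "'p measure \<Rightarrow> ('p \<Rightarrow> real) \<Rightarrow> 'p measure" where
  "posterior_of prior L = density prior (\<lambda>\<theta>. ennreal (L \<theta> / (\<integral>\<theta>'. L \<theta>' \<partial>prior)))"

definition bayes_well_defined :: "'p measure \<Rightarrow> ('p \<Rightarrow> real) \<Rightarrow> bool" where
  "bayes_well_defined prior L \<longleftrightarrow> integrable prior L \<and> 0 < (\<integral>\<theta>. L \<theta> \<partial>prior)"

section \<open>Sensitivity and covariance\<close>

text \<open>
  The family of distortions is indexed by \<open>\<alpha> \<ge> \<alpha>0\<close> and the derivative at \<open>\<alpha>0\<close> is the right derivative.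
\<close>

definition distorted_expectation ::
    "(real \<Rightarrow> real) \<Rightarrow> 'p measure \<Rightarrow> ('p \<Rightarrow> real ^ 'd \<Rightarrow> real) \<Rightarrow> nat \<Rightarrow> (nat \<Rightarrow> real ^ 'd) \<Rightarrow>
      ('p \<Rightarrow> real ^ 's) \<Rightarrow> real ^ 's" where
  "distorted_expectation h prior f n x g = (\<integral>\<theta>. g \<theta> \<partial>posterior_of prior (distorted_likelihood h f n x))"

definition local_sensitivity ::
    "(real \<Rightarrow> real \<Rightarrow> real) \<Rightarrow> real \<Rightarrow> 'p measure \<Rightarrow> ('p \<Rightarrow> real ^ 'd \<Rightarrow> real) \<Rightarrow> nat \<Rightarrow>
      (nat \<Rightarrow> real ^ 'd) \<Rightarrow> ('p \<Rightarrow> real ^ 's) \<Rightarrow> real ^ 's" where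
  "local_sensitivity h \<alpha>0 prior f n x g =
     vector_derivative (\<lambda>\<alpha>. distorted_expectation (h \<alpha>) prior f n x g) (at \<alpha>0 within {\<alpha>0..})"

text \<open>
  Right differentiability of \<open>log (\<phi> \<alpha>)\<close> at \<open>\<alpha>0\<close> includes that the logarithm is real-valued near
  \<open>\<alpha>0\<close>. This has to be said explicitly, because \<open>ln\<close> is total with \<open>ln 0 = 0\<close>: without positivity,
  \<open>\<alpha> \<mapsto> ln (\<alpha> * 0 powr (\<alpha> - 1))\<close> would count as differentiable.
\<close>

definition log_right_differentiable :: "(real \<Rightarrow> real) \<Rightarrow> real \<Rightarrow> bool" where
  "log_right_differentiable \<phi> \<alpha>0 \<longleftrightarrow>
     0 < \<phi> \<alpha>0 \<and> eventually (\<lambda>\<alpha>. 0 < \<phi> \<alpha>) (at_right \<alpha>0) \<and>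
     (\<lambda>\<alpha>. ln (\<phi> \<alpha>)) differentiable (at \<alpha>0 within {\<alpha>0..})"

definition covariance :: "'p measure \<Rightarrow> ('p \<Rightarrow> real) \<Rightarrow> ('p \<Rightarrow> real) \<Rightarrow> real" where
  "covariance M X Y = (\<integral>\<theta>. (X \<theta> - (\<integral>\<theta>'. X \<theta>' \<partial>M)) * (Y \<theta> - (\<integral>\<theta>'. Y \<theta>' \<partial>M)) \<partial>M)"

definition vec_covariance :: "'p measure \<Rightarrow> ('p \<Rightarrow> real ^ 's) \<Rightarrow> ('p \<Rightarrow> real) \<Rightarrow> real ^ 's" where
  "vec_covariance M g T = (\<chi> j. covariance M (\<lambda>\<theta>. g \<theta> $ j) T)"

end

theory Submission
  imports Defs
begin

text \<open>
  Differentiability of \<open>log h'\<^sub>\<alpha>(F)\<close> forces \<open>F > 0\<close> almost everywhere, so the distorted likelihood is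
  \<open>\<alpha> ^ n * exp ((\<alpha> - 1) * T) * l\<close> with the likelihood \<open>l\<close> and \<open>T = \<Sum>i. ln F\<^sub>i \<le> 0\<close>; its derivative at
  \<open>\<alpha> = 1\<close> is \<open>(n + T) * l\<close>. Differentiating numerator and normalising constant of the posterior
  expectation under the integral sign, the contributions of \<open>n\<close> cancel in the quotient rule, which leaves
  the covariance. The numerator is dominated by \<open>G\<close>, the normalising constant by
  \<open>(3 ^ n - T) * l\<close>. The domination also yields the integrability of \<open>g\<close> itself: the difference
  quotient for \<open>\<delta>0\<close> and the derivative \<open>n + T\<close>, as functions of \<open>T\<close>, have no common zero and
  are not simultaneously small, so \<open>l * norm g\<close> is at most a multiple of \<open>G\<close>.
\<close>

section \<open>Differentiation under the integral sign from the right\<close>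

text \<open>Both sides say that the remainder, divided by \<open>y - x\<close>, tends to 0 in norm.
  The form with difference quotients is the one to which dominated convergence applies.\<close>

lemma has_vector_derivative_iff_tendsto:
  fixes f :: "real \<Rightarrow> 'a::real_normed_vector"
  shows "(f has_vector_derivative D) (at x within S) \<longleftrightarrow>
           ((\<lambda>y. (f y - f x) /\<^sub>R (y - x)) \<longlongrightarrow> D) (at x within S)"
proof -
  have "norm ((f y - f x) /\<^sub>R (y - x) - D) = norm (f y - f x - (y - x) *\<^sub>R D) / norm (y - x)"
    if "y \<noteq> x" for y
  proof -
    have "(f y - f x) /\<^sub>R (y - x) - D = (f y - f x - (y - x) *\<^sub>R D) /\<^sub>R (y - x)"
      using that by (simp add: scaleR_diff_right)
    then show ?thesis by (simp add: divide_inverse mult.commute)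
  qed
  then have "((\<lambda>y. norm ((f y - f x) /\<^sub>R (y - x) - D)) \<longlongrightarrow> 0) (at x within S) \<longleftrightarrow>
      ((\<lambda>y. norm (f y - f x - (y - x) *\<^sub>R D) / norm (y - x)) \<longlongrightarrow> 0) (at x within S)"
    by (intro Lim_cong_within) auto
  moreover have "((\<lambda>y. (f y - f x) /\<^sub>R (y - x)) \<longlongrightarrow> D) (at x within S) \<longleftrightarrow>
      ((\<lambda>y. norm ((f y - f x) /\<^sub>R (y - x) - D)) \<longlongrightarrow> 0) (at x within S)"
    by (simp add: LIM_zero_iff tendsto_norm_zero_iff)
  ultimately show ?thesis
    by (simp add: has_vector_derivative_def has_derivative_iff_norm bounded_linear_scaleR_left)
qed

text \<open>Dominated convergence for the difference quotients along each sequence that tends to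
  \<open>a\<close> from the right. The null set in \<open>bound\<close> may depend on \<delta>:
  along a sequence only countably many values of \<delta> occur.\<close>

lemma right_derivative_integral_dominated:
  fixes W :: "real \<Rightarrow> 'a \<Rightarrow> 'b::{banach, second_countable_topology}"
  assumes int: "\<And>\<alpha>. a \<le> \<alpha> \<Longrightarrow> integrable M (W \<alpha>)"
    and G: "integrable M G" and \<epsilon>: "0 < \<epsilon>"
    and bound: "\<And>\<delta>. 0 < \<delta> \<Longrightarrow> \<delta> \<le> \<epsilon> \<Longrightarrow> AE \<theta> in M. norm ((W (a + \<delta>) \<theta> - W a \<theta>) /\<^sub>R \<delta>) \<le> G \<theta>"
    and deriv: "AE \<theta> in M. ((\<lambda>\<alpha>. W \<alpha> \<theta>) has_vector_derivative D \<theta>) (at a within {a..})"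
    and D: "D \<in> borel_measurable M"
  shows "((\<lambda>\<alpha>. \<integral>\<theta>. W \<alpha> \<theta> \<partial>M) has_vector_derivative (\<integral>\<theta>. D \<theta> \<partial>M)) (at a within {a..})"
proof -
  define Q where "Q \<alpha> \<theta> = (W \<alpha> \<theta> - W a \<theta>) /\<^sub>R (\<alpha> - a)" for \<alpha> \<theta>
  have lim: "AE \<theta> in M. ((\<lambda>\<alpha>. Q \<alpha> \<theta>) \<longlongrightarrow> D \<theta>) (at_right a)"
    using deriv by (simp add: has_vector_derivative_iff_tendsto at_within_Ici_at_right Q_def)
  have Q_meas: "Q \<alpha> \<in> borel_measurable M" if "a \<le> \<alpha>" for \<alpha>
    using int[OF that] int[of a] unfolding Q_def by (intro measurable) auto
  have Q_bound: "AE \<theta> in M. norm (Q \<alpha> \<theta>) \<le> G \<theta>" if "a < \<alpha>" "\<alpha> < a + \<epsilon>" for \<alpha>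
    using bound[of "\<alpha> - a"] that by (simp add: Q_def)
  have seq: "AE \<theta> in M. (\<lambda>k. Q (S k) \<theta>) \<longlonglongrightarrow> D \<theta>"
    if "\<And>k. a < S k" "S \<longlonglongrightarrow> a" for S :: "nat \<Rightarrow> real"
    using lim
  proof eventually_elim
    case (elim \<theta>)
    have "filterlim S (at_right a) sequentially"
      using that by (auto simp: filterlim_at intro!: always_eventually)
    with elim show ?case by (rule filterlim_compose)
  qed
  \<comment> \<open>The limit in the real variable \<alpha> is reduced to sequences in the interval
    from \<open>a\<close> to \<open>a + \<epsilon>\<close>, where \<open>G\<close> is a
    majorant.\<close>
  have "((\<lambda>\<alpha>. \<integral>\<theta>. Q \<alpha> \<theta> \<partial>M) \<longlongrightarrow> (\<integral>\<theta>. D \<theta> \<partial>M)) (at_right a)"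
  proof (rule tendsto_at_right_sequentially[where b = "a + \<epsilon>"])
    show "a < a + \<epsilon>" using \<epsilon> by simp
    fix S :: "nat \<Rightarrow> real"
    assume S: "\<And>k. a < S k" "\<And>k. S k < a + \<epsilon>" "S \<longlonglongrightarrow> a"
    show "(\<lambda>k. \<integral>\<theta>. Q (S k) \<theta> \<partial>M) \<longlonglongrightarrow> (\<integral>\<theta>. D \<theta> \<partial>M)"
      using seq[OF S(1,3)] Q_meas Q_bound S G D
      by (intro integral_dominated_convergence[where w = G]) (auto intro: less_imp_le)
  qed
  moreover have "eventually (\<lambda>\<alpha>. (\<integral>\<theta>. Q \<alpha> \<theta> \<partial>M) = ((\<integral>\<theta>. W \<alpha> \<theta> \<partial>M) - (\<integral>\<theta>. W a \<theta> \<partial>M)) /\<^sub>R (\<alpha> - a))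
      (at_right a)"
    using eventually_at_right_less[of a] by eventually_elim (auto simp: Q_def int)
  ultimately show "((\<lambda>\<alpha>. \<integral>\<theta>. W \<alpha> \<theta> \<partial>M) has_vector_derivative (\<integral>\<theta>. D \<theta> \<partial>M)) (at a within {a..})"
    unfolding has_vector_derivative_iff_tendsto at_within_Ici_at_right
    by (rule Lim_transform_eventually)
qed

section \<open>Posteriors\<close>

text \<open>This serves to replace the distorted likelihood by its exponential form, which is only
  valid outside a null set.\<close>

lemma posterior_of_cong:
  assumes "L \<in> borel_measurable M" "L' \<in> borel_measurable M" "AE \<theta> in M. L \<theta> = L' \<theta>"
  shows "posterior_of M L = posterior_of M L'"
proof -
  have "(\<integral>\<theta>. L \<theta> \<partial>M) = (\<integral>\<theta>. L' \<theta> \<partial>M)"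
    using assms by (intro integral_cong_AE) auto
  then show ?thesis
    unfolding posterior_of_def using assms by (intro density_cong) auto
qed

lemma prob_space_posterior_of:
  assumes L: "bayes_well_defined M L" and nonneg: "AE \<theta> in M. 0 \<le> L \<theta>"
  shows "prob_space (posterior_of M L)"
proof
  let ?Z = "\<integral>\<theta>. L \<theta> \<partial>M"
  have Z: "0 < ?Z" and int: "integrable M L" using L by (auto simp: bayes_well_defined_def)
  have "(\<integral>\<^sup>+\<theta>. ennreal (L \<theta> / ?Z) \<partial>M) = ennreal (\<integral>\<theta>. L \<theta> / ?Z \<partial>M)"
    using int nonneg Z by (intro nn_integral_eq_integral) auto
  also have "\<dots> = 1" using Z by simp
  finally show "emeasure (posterior_of M L) (space (posterior_of M L)) = 1"
    using int by (simp add: posterior_of_def emeasure_density cong: nn_integral_cong)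
qed

lemma integrable_posterior_of_iff:
  fixes g :: "'a \<Rightarrow> 'b::{banach, second_countable_topology}"
  assumes L: "bayes_well_defined M L" and nonneg: "AE \<theta> in M. 0 \<le> L \<theta>" and g: "g \<in> borel_measurable M"
  shows "integrable (posterior_of M L) g \<longleftrightarrow> integrable M (\<lambda>\<theta>. L \<theta> *\<^sub>R g \<theta>)"
proof -
  let ?Z = "\<integral>\<theta>. L \<theta> \<partial>M"
  have Z: "0 < ?Z" and int: "integrable M L" using L by (auto simp: bayes_well_defined_def)
  have "integrable (posterior_of M L) g \<longleftrightarrow> integrable M (\<lambda>\<theta>. (L \<theta> / ?Z) *\<^sub>R g \<theta>)"
    unfolding posterior_of_def using int g nonneg Z by (intro integrable_density) auto
  also have "(\<lambda>\<theta>. (L \<theta> / ?Z) *\<^sub>R g \<theta>) = (\<lambda>\<theta>. (1 / ?Z) *\<^sub>R (L \<theta> *\<^sub>R g \<theta>))"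
    by simp
  also have "integrable M \<dots> \<longleftrightarrow> integrable M (\<lambda>\<theta>. L \<theta> *\<^sub>R g \<theta>)"
    using Z integrable_scaleR_right[of ?Z M "\<lambda>\<theta>. (1 / ?Z) *\<^sub>R (L \<theta> *\<^sub>R g \<theta>)"]
      integrable_scaleR_right[of "1 / ?Z" M "\<lambda>\<theta>. L \<theta> *\<^sub>R g \<theta>"]
    by auto
  finally show ?thesis .
qed

lemma integral_posterior_of:
  fixes g :: "'a \<Rightarrow> 'b::{banach, second_countable_topology}"
  assumes L: "bayes_well_defined M L" and nonneg: "AE \<theta> in M. 0 \<le> L \<theta>" and g: "g \<in> borel_measurable M"
  shows "(\<integral>\<theta>. g \<theta> \<partial>posterior_of M L) = (1 / (\<integral>\<theta>. L \<theta> \<partial>M)) *\<^sub>R (\<integral>\<theta>. L \<theta> *\<^sub>R g \<theta> \<partial>M)"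
proof -
  let ?Z = "\<integral>\<theta>. L \<theta> \<partial>M"
  have Z: "0 < ?Z" and int: "integrable M L" using L by (auto simp: bayes_well_defined_def)
  have "(\<integral>\<theta>. g \<theta> \<partial>posterior_of M L) = (\<integral>\<theta>. (L \<theta> / ?Z) *\<^sub>R g \<theta> \<partial>M)"
    unfolding posterior_of_def using int g nonneg Z by (intro integral_density) auto
  also have "\<dots> = (\<integral>\<theta>. (1 / ?Z) *\<^sub>R (L \<theta> *\<^sub>R g \<theta>) \<partial>M)"
    by simp
  finally show ?thesis by (simp only: integral_scaleR_right)
qed

text \<open>The usual expansion of the centred product, componentwise. Integrability of the product
  \<open>T *\<^sub>R g\<close> takes the place of second moments of \<open>g\<close> and
  \<open>T\<close>.\<close>

lemma (in prob_space) vec_covariance_eq: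
  fixes g :: "'a \<Rightarrow> real ^ 's"
  assumes g: "integrable M g" and T: "integrable M T" and Tg: "integrable M (\<lambda>\<theta>. T \<theta> *\<^sub>R g \<theta>)"
  shows "vec_covariance M g T = (\<integral>\<theta>. T \<theta> *\<^sub>R g \<theta> \<partial>M) - (\<integral>\<theta>. T \<theta> \<partial>M) *\<^sub>R (\<integral>\<theta>. g \<theta> \<partial>M)"
proof (rule vec_eq_iff[THEN iffD2], rule allI)
  fix j
  have nth: "integrable M (\<lambda>\<theta>. h \<theta> $ j)" "(\<integral>\<theta>. h \<theta> $ j \<partial>M) = (\<integral>\<theta>. h \<theta> \<partial>M) $ j"
    if "integrable M h" for h :: "'a \<Rightarrow> real ^ 's"
    using that by (auto intro: integrable_bounded_linear integral_bounded_linear bounded_linear_vec_nth)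
  have Tgj: "integrable M (\<lambda>\<theta>. T \<theta> * g \<theta> $ j)" using nth(1)[OF Tg] by simp
  let ?m = "\<integral>\<theta>. g \<theta> $ j \<partial>M" and ?t = "\<integral>\<theta>. T \<theta> \<partial>M"
  have "covariance M (\<lambda>\<theta>. g \<theta> $ j) T = (\<integral>\<theta>. T \<theta> * g \<theta> $ j - ?t * g \<theta> $ j - ?m * T \<theta> + ?m * ?t \<partial>M)"
    unfolding covariance_def by (intro Bochner_Integration.integral_cong refl) (simp add: algebra_simps)
  also have "\<dots> = (\<integral>\<theta>. T \<theta> * g \<theta> $ j \<partial>M) - ?t * ?m"
    using nth(1)[OF g] T Tgj by (simp add: prob_space)
  also have "\<dots> = ((\<integral>\<theta>. T \<theta> *\<^sub>R g \<theta> \<partial>M) - ?t *\<^sub>R (\<integral>\<theta>. g \<theta> \<partial>M)) $ j"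
    using nth(2)[OF Tg] nth(2)[OF g] by simp
  finally show "vec_covariance M g T $ j = \<dots>" by (simp add: vec_covariance_def)
qed

section \<open>Exponentially tilted likelihoods\<close>

text \<open>A bound linear in \<delta> with a slope that depends on \<open>n\<close> alone, for use
  in an integrable majorant uniform in \<delta>. The slope is crude: the induction step needs a
  number at least three times the previous one.\<close>

lemma power_increment_le:
  fixes \<delta> :: real
  assumes "0 \<le> \<delta>" "\<delta> \<le> 1"
  shows "(1 + \<delta>) ^ n \<le> 1 + 3 ^ n * \<delta>"
proof (induction n)
  case (Suc n)
  have "(1 + \<delta>) ^ Suc n \<le> (1 + \<delta>) * (1 + 3 ^ n * \<delta>)"
    using Suc assms by (simp add: mult_left_mono)
  also have "\<dots> = 1 + (1 + 3 ^ n + 3 ^ n * \<delta>) * \<delta>" by (simp add: algebra_simps)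
  also have "\<dots> \<le> 1 + (3 ^ n + 3 ^ n + 3 ^ n) * \<delta>"
  proof -
    have "1 \<le> (3::real) ^ n" by simp
    moreover have "3 ^ n * \<delta> \<le> 3 ^ n" using assms by simp
    ultimately have "1 + 3 ^ n + 3 ^ n * \<delta> \<le> 3 ^ n + 3 ^ n + 3 ^ n" by linarith
    then show ?thesis using assms by (intro add_left_mono mult_right_mono) auto
  qed
  finally show ?case by (simp add: algebra_simps)
qed (use assms in simp)

text \<open>
  Both functions increase in \<open>t\<close>, and the zero \<open>-n\<close> of the derivative lies below the zero of the
  increment: above their midpoint the derivative is large, below it the increment is.
\<close>

lemma tilt_increment_or_derivative_away_from_0:
  fixes \<delta> :: real and n :: nat
  assumes n: "1 \<le> n" and \<delta>: "0 < \<delta>"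
  obtains c where "0 < c" "\<And>t. c \<le> \<bar>real n + t\<bar> \<or> c \<le> \<bar>((1 + \<delta>) ^ n * exp (\<delta> * t) - 1) / \<delta>\<bar>"
proof -
  \<comment> \<open>\<open>z\<close> is the zero of the increment in \<open>t\<close>,
    \<open>m\<close> the midpoint between \<open>- n\<close> and \<open>z\<close>, and
    \<open>c\<close> the smaller of the absolute values of the two functions at
    \<open>m\<close>.\<close>
  define z where "z = - (real n * ln (1 + \<delta>) / \<delta>)"
  define m where "m = (z - real n) / 2"
  define c where "c = min (real n + m) ((1 - (1 + \<delta>) ^ n * exp (\<delta> * m)) / \<delta>)"
  \<comment> \<open>The strict inequality \<open>ln (1 + \<delta>) < \<delta>\<close> separates the
    two zeros. For \<open>n = 0\<close> both would be 0, hence the assumption on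
    \<open>n\<close>.\<close>
  have "real n * (ln (1 + \<delta>) / \<delta>) < real n * 1"
    using n \<delta> ln_add_one_self_less_self[OF \<delta>] by (intro mult_strict_left_mono) auto
  then have z: "- real n < z" by (simp add: z_def)
  then have m: "- real n < m" "m < z" by (auto simp: m_def)
  have "(1 + \<delta>) ^ n * exp (\<delta> * m) < (1 + \<delta>) ^ n * exp (\<delta> * z)"
    using m \<delta> by (intro mult_strict_left_mono) auto
  also have "\<dots> = 1"
    using \<delta> by (simp add: z_def exp_minus exp_of_nat_mult)
  finally have "0 < c" using m \<delta> by (simp add: c_def)
  moreover have "c \<le> \<bar>real n + t\<bar> \<or> c \<le> \<bar>((1 + \<delta>) ^ n * exp (\<delta> * t) - 1) / \<delta>\<bar>" for t
  proof (cases "m \<le> t")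
    case True
    then show ?thesis by (auto simp: c_def)
  next
    case False
    then have "(1 + \<delta>) ^ n * exp (\<delta> * t) \<le> (1 + \<delta>) ^ n * exp (\<delta> * m)"
      using \<delta> by (intro mult_left_mono) auto
    then have "(1 - (1 + \<delta>) ^ n * exp (\<delta> * m)) / \<delta> \<le> - (((1 + \<delta>) ^ n * exp (\<delta> * t) - 1) / \<delta>)"
      using \<delta> by (simp add: field_simps)
    then have "c \<le> - (((1 + \<delta>) ^ n * exp (\<delta> * t) - 1) / \<delta>)" by (simp add: c_def)
    then show ?thesis by linarith
  qed
  ultimately show ?thesis by (rule that)
qed

text \<open>The analytic content separated from the statistical model: \<open>T\<close> stands for
  the sum of the \<open>ln F\<close>, and its sign keeps \<open>exp ((\<alpha> - 1) * T)\<close>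
  below 1 for \<alpha> \<ge> 1.\<close>

locale tilted_likelihood =
  fixes M :: "'a measure" and l T :: "'a \<Rightarrow> real" and n :: nat
  assumes well_defined: "bayes_well_defined M l"
    and l_nonneg: "AE \<theta> in M. 0 \<le> l \<theta>"
    and T_measurable: "T \<in> borel_measurable M"
    and T_nonpos: "AE \<theta> in M. T \<theta> \<le> 0"
begin

text \<open>An unnormalised exponential family with statistic \<open>T\<close>. The factor
  \<open>\<alpha> ^ n\<close> disappears after normalisation, but it is kept because the domination
  hypothesis concerns unnormalised increments.\<close>

definition tilt :: "real \<Rightarrow> 'a \<Rightarrow> real" where
  "tilt \<alpha> \<theta> = \<alpha> ^ n * exp ((\<alpha> - 1) * T \<theta>) * l \<theta>"

lemma integrable_l: "integrable M l"
  using well_defined by (simp add: bayes_well_defined_def)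

lemma tilt_1 [simp]: "tilt 1 = l"
  by (simp add: tilt_def fun_eq_iff)

lemma tilt_measurable: "tilt \<alpha> \<in> borel_measurable M"
  using integrable_l T_measurable unfolding tilt_def by measurable

lemma tilt_nonneg: "0 \<le> \<alpha> \<Longrightarrow> AE \<theta> in M. 0 \<le> tilt \<alpha> \<theta>"
  using l_nonneg by eventually_elim (simp add: tilt_def)

lemma tilt_le:
  assumes "1 \<le> \<alpha>"
  shows "AE \<theta> in M. tilt \<alpha> \<theta> \<le> \<alpha> ^ n * l \<theta>"
  using l_nonneg T_nonpos
proof eventually_elim
  case (elim \<theta>)
  then have "exp ((\<alpha> - 1) * T \<theta>) \<le> 1" using assms by (simp add: mult_nonneg_nonpos)
  then show ?case
    using assms elim unfolding tilt_def by (intro mult_right_mono) (auto simp: mult_left_le)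
qed

lemma integrable_tilt_scaleR:
  fixes g :: "'a \<Rightarrow> 'b::{banach, second_countable_topology}"
  assumes \<alpha>: "1 \<le> \<alpha>" and g: "g \<in> borel_measurable M" and int: "integrable M (\<lambda>\<theta>. l \<theta> *\<^sub>R g \<theta>)"
  shows "integrable M (\<lambda>\<theta>. tilt \<alpha> \<theta> *\<^sub>R g \<theta>)"
proof (rule Bochner_Integration.integrable_bound)
  show "integrable M (\<lambda>\<theta>. \<alpha> ^ n *\<^sub>R (l \<theta> *\<^sub>R g \<theta>))" using int by (rule integrable_scaleR_right)
  show "(\<lambda>\<theta>. tilt \<alpha> \<theta> *\<^sub>R g \<theta>) \<in> borel_measurable M"
    using tilt_measurable g by measurable
  have "0 \<le> \<alpha>" using \<alpha> by simp
  from tilt_nonneg[OF this] tilt_le[OF \<alpha>]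
  show "AE \<theta> in M. norm (tilt \<alpha> \<theta> *\<^sub>R g \<theta>) \<le> norm (\<alpha> ^ n *\<^sub>R (l \<theta> *\<^sub>R g \<theta>))"
  proof eventually_elim
    case (elim \<theta>)
    then have "norm (tilt \<alpha> \<theta>) \<le> norm (\<alpha> ^ n * l \<theta>)" by simp
    then show ?case
      unfolding scaleR_scaleR norm_scaleR by (intro mult_right_mono) auto
  qed
qed

lemma integrable_tilt: "1 \<le> \<alpha> \<Longrightarrow> integrable M (tilt \<alpha>)"
  using integrable_tilt_scaleR[of \<alpha> "\<lambda>_. 1::real"] integrable_l by simp

text \<open>The tilting factor is strictly positive, so \<open>tilt \<alpha>\<close> can vanish
  almost everywhere only if \<open>l\<close> does, which \<open>well_defined\<close>
  excludes.\<close>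

lemma tilt_well_defined:
  assumes \<alpha>: "1 \<le> \<alpha>"
  shows "bayes_well_defined M (tilt \<alpha>)"
proof -
  have nn: "AE \<theta> in M. 0 \<le> tilt \<alpha> \<theta>" using tilt_nonneg \<alpha> by simp
  have "(\<integral>\<theta>. tilt \<alpha> \<theta> \<partial>M) \<noteq> 0"
  proof
    assume "(\<integral>\<theta>. tilt \<alpha> \<theta> \<partial>M) = 0"
    then have "AE \<theta> in M. tilt \<alpha> \<theta> = 0"
      using integral_nonneg_eq_0_iff_AE[OF integrable_tilt[OF \<alpha>] nn] by simp
    then have "AE \<theta> in M. l \<theta> = 0" by eventually_elim (use \<alpha> in \<open>simp add: tilt_def\<close>)
    then have "(\<integral>\<theta>. l \<theta> \<partial>M) = 0" by (rule integral_eq_zero_AE)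
    then show False using well_defined by (simp add: bayes_well_defined_def)
  qed
  moreover have "0 \<le> (\<integral>\<theta>. tilt \<alpha> \<theta> \<partial>M)" using nn by (rule integral_nonneg_AE)
  ultimately show ?thesis using integrable_tilt[OF \<alpha>] by (simp add: bayes_well_defined_def)
qed

lemma tilt_has_derivative:
  "((\<lambda>\<alpha>. tilt \<alpha> \<theta>) has_real_derivative (real n + T \<theta>) * l \<theta>) (at 1 within S)"
  unfolding tilt_def by (auto intro!: derivative_eq_intros simp: algebra_simps)

text \<open>A bound on increments multiplied by \<open>g\<close> says nothing where \<open>g\<close>
  vanishes, so the normalising constant needs a majorant of its own; integrability of
  \<open>l * T\<close> provides it.\<close>

lemma tilt_integral_has_derivative:
  assumes T: "integrable M (\<lambda>\<theta>. l \<theta> * T \<theta>)"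
  shows "((\<lambda>\<alpha>. \<integral>\<theta>. tilt \<alpha> \<theta> \<partial>M) has_real_derivative (\<integral>\<theta>. (real n + T \<theta>) * l \<theta> \<partial>M)) (at 1 within {1..})"
  unfolding has_real_derivative_iff_has_vector_derivative
proof (rule right_derivative_integral_dominated)
  show "integrable M (tilt \<alpha>)" if "1 \<le> \<alpha>" for \<alpha> using that by (rule integrable_tilt)
  show "integrable M (\<lambda>\<theta>. 3 ^ n * l \<theta> - l \<theta> * T \<theta>)" using integrable_l T by simp
  show "(0::real) < 1" by simp
  show "AE \<theta> in M. ((\<lambda>\<alpha>. tilt \<alpha> \<theta>) has_vector_derivative (real n + T \<theta>) * l \<theta>) (at 1 within {1..})"
    using tilt_has_derivative by (simp add: has_real_derivative_iff_has_vector_derivative)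
  show "(\<lambda>\<theta>. (real n + T \<theta>) * l \<theta>) \<in> borel_measurable M"
    using integrable_l T_measurable by measurable
  fix \<delta> :: real assume \<delta>: "0 < \<delta>" "\<delta> \<le> 1"
  show "AE \<theta> in M. norm ((tilt (1 + \<delta>) \<theta> - tilt 1 \<theta>) /\<^sub>R \<delta>) \<le> 3 ^ n * l \<theta> - l \<theta> * T \<theta>"
    using l_nonneg T_nonpos
  proof eventually_elim
    case (elim \<theta>)
    define e where "e = exp (\<delta> * T \<theta>)"
    \<comment> \<open>The increment is bounded above by means of \<open>e \<le> 1\<close> and below
      by means of \<open>1 + x \<le> exp x\<close>; the two bounds account for the summands
      \<open>3 ^ n\<close> and \<open>- T\<close> of the majorant.\<close>
    have e: "0 < e" "e \<le> 1" "1 + \<delta> * T \<theta> \<le> e"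
      using elim \<delta> by (auto simp: e_def mult_nonneg_nonpos)
    have p: "1 \<le> (1 + \<delta>) ^ n" using \<delta> by simp
    have "(1 + \<delta>) ^ n * e \<le> (1 + \<delta>) ^ n" using e p by (simp add: mult_left_le)
    also have "\<dots> \<le> 1 + 3 ^ n * \<delta>" using \<delta> by (intro power_increment_le) auto
    finally have up: "(1 + \<delta>) ^ n * e - 1 \<le> 3 ^ n * \<delta>" by simp
    have "1 * e \<le> (1 + \<delta>) ^ n * e" using p e by (intro mult_right_mono) auto
    then have lo: "\<delta> * T \<theta> \<le> (1 + \<delta>) ^ n * e - 1" using e by linarith
    have nn: "0 \<le> 3 ^ n * \<delta>" "\<delta> * T \<theta> \<le> 0" using \<delta> elim by (auto simp: mult_nonneg_nonpos)
    have "\<bar>(1 + \<delta>) ^ n * e - 1\<bar> \<le> \<delta> * (3 ^ n - T \<theta>)"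
      using up lo nn by (simp add: algebra_simps abs_le_iff)
    then have "\<bar>(1 + \<delta>) ^ n * e - 1\<bar> / \<delta> \<le> 3 ^ n - T \<theta>"
      using \<delta> by (simp add: pos_divide_le_eq mult.commute)
    then have "\<bar>(1 + \<delta>) ^ n * e - 1\<bar> / \<delta> * l \<theta> \<le> (3 ^ n - T \<theta>) * l \<theta>"
      using elim by (intro mult_right_mono)
    moreover have "(tilt (1 + \<delta>) \<theta> - tilt 1 \<theta>) /\<^sub>R \<delta> = ((1 + \<delta>) ^ n * e - 1) / \<delta> * l \<theta>"
      by (simp add: tilt_def e_def algebra_simps divide_inverse)
    then have "norm ((tilt (1 + \<delta>) \<theta> - tilt 1 \<theta>) /\<^sub>R \<delta>) = \<bar>(1 + \<delta>) ^ n * e - 1\<bar> / \<delta> * l \<theta>"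
      using \<delta> elim by (simp only: real_norm_def abs_mult abs_divide abs_of_nonneg abs_of_pos)
    ultimately show ?case by (simp add: algebra_simps)
  qed
qed

section \<open>Moments under the domination hypothesis\<close>

context
  fixes g :: "'a \<Rightarrow> 'b::{banach, second_countable_topology}" and G :: "'a \<Rightarrow> real" and \<delta>0 :: real
  assumes n: "1 \<le> n" and \<delta>0: "0 < \<delta>0"
    and g: "g \<in> borel_measurable M" and G: "integrable M G"
    and dominated: "\<And>\<delta>. 0 < \<delta> \<Longrightarrow> \<delta> \<le> \<delta>0 \<Longrightarrow>
          AE \<theta> in M. norm (((tilt (1 + \<delta>) \<theta> - tilt 1 \<theta>) / \<delta>) *\<^sub>R g \<theta>) \<le> G \<theta>"
begin

text \<open>The bound passes to the limit of the difference quotients. The exceptional set in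
  \<open>dominated\<close> depends on \<delta>, so the limit is taken along the sequence
  \<open>\<delta>0 / (k + 1)\<close>, for which a single null set suffices.\<close>

lemma tilt_derivative_dominated: "AE \<theta> in M. norm (((real n + T \<theta>) * l \<theta>) *\<^sub>R g \<theta>) \<le> G \<theta>"
proof -
  define S where "S k = \<delta>0 / real (Suc k)" for k
  have S: "0 < S k" "S k \<le> \<delta>0" for k using \<delta>0 by (auto simp: S_def divide_simps)
  have "S \<longlonglongrightarrow> 0"
    unfolding S_def by (rule LIMSEQ_Suc) (rule lim_const_over_n)
  then have S_lim: "filterlim (\<lambda>k. 1 + S k) (at 1) sequentially"
    using S(1) by (auto simp: filterlim_at intro!: always_eventually tendsto_eq_intros less_imp_neq[symmetric])
  have "AE \<theta> in M. \<forall>k. norm (((tilt (1 + S k) \<theta> - tilt 1 \<theta>) / S k) *\<^sub>R g \<theta>) \<le> G \<theta>"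
    unfolding AE_all_countable using dominated[OF S] by blast
  then show ?thesis
  proof eventually_elim
    case (elim \<theta>)
    have "((\<lambda>\<alpha>. (tilt \<alpha> \<theta> - tilt 1 \<theta>) / (\<alpha> - 1)) \<longlongrightarrow> (real n + T \<theta>) * l \<theta>) (at 1)"
      using tilt_has_derivative[where S = UNIV] by (simp only: has_field_derivative_iff)
    from filterlim_compose[OF this S_lim]
    have "(\<lambda>k. (tilt (1 + S k) \<theta> - tilt 1 \<theta>) / S k) \<longlonglongrightarrow> (real n + T \<theta>) * l \<theta>" by simp
    then have "(\<lambda>k. norm (((tilt (1 + S k) \<theta> - tilt 1 \<theta>) / S k) *\<^sub>R g \<theta>))
        \<longlonglongrightarrow> norm (((real n + T \<theta>) * l \<theta>) *\<^sub>R g \<theta>)"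
      by (intro tendsto_intros)
    then show ?case by (rule Lim_bounded) (use elim in auto)
  qed
qed

text \<open>Two multiples of \<open>l *\<^sub>R g\<close> are bounded by \<open>G\<close>, and at
  every point one of the two factors has absolute value at least \<open>c\<close>; hence
  \<open>G / c\<close> is a majorant.\<close>

lemma integrable_likelihood_scaleR: "integrable M (\<lambda>\<theta>. l \<theta> *\<^sub>R g \<theta>)"
proof -
  obtain c where c: "0 < c"
    "\<And>t. c \<le> \<bar>real n + t\<bar> \<or> c \<le> \<bar>((1 + \<delta>0) ^ n * exp (\<delta>0 * t) - 1) / \<delta>0\<bar>"
    using tilt_increment_or_derivative_away_from_0[OF n \<delta>0] by metis
  show ?thesis
  proof (rule Bochner_Integration.integrable_bound)
    show "integrable M (\<lambda>\<theta>. G \<theta> / c)" using G by simp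
    show "(\<lambda>\<theta>. l \<theta> *\<^sub>R g \<theta>) \<in> borel_measurable M" using integrable_l g by measurable
    show "AE \<theta> in M. norm (l \<theta> *\<^sub>R g \<theta>) \<le> norm (G \<theta> / c)"
      using tilt_derivative_dominated dominated[OF \<delta>0 order_refl]
    proof eventually_elim
      case (elim \<theta>)
      have eq: "(tilt (1 + \<delta>0) \<theta> - tilt 1 \<theta>) / \<delta>0 = ((1 + \<delta>0) ^ n * exp (\<delta>0 * T \<theta>) - 1) / \<delta>0 * l \<theta>"
        by (simp add: tilt_def algebra_simps)
      \<comment> \<open>\<open>q\<close> is \<open>n + T \<theta>\<close> or the increment quotient
        for \<delta>0, whichever is at least \<open>c\<close> in absolute value.\<close>
      obtain q where q: "c \<le> \<bar>q\<bar>" "norm ((q * l \<theta>) *\<^sub>R g \<theta>) \<le> G \<theta>"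
        using c(2)[of "T \<theta>"] elim unfolding eq by blast
      have "c * norm (l \<theta> *\<^sub>R g \<theta>) \<le> \<bar>q\<bar> * norm (l \<theta> *\<^sub>R g \<theta>)"
        using q by (intro mult_right_mono) auto
      also have "\<dots> \<le> G \<theta>" using q(2) by (simp add: abs_mult mult.assoc)
      finally have "norm (l \<theta> *\<^sub>R g \<theta>) \<le> G \<theta> / c" using c(1) by (simp add: pos_le_divide_eq mult.commute)
      also have "\<dots> \<le> norm (G \<theta> / c)" by (simp only: real_norm_def abs_ge_self)
      finally show ?case .
    qed
  qed
qed

text \<open>The integrand is the derivative \<open>((n + T) * l) *\<^sub>R g\<close>, dominated by
  \<open>G\<close>, minus \<open>n\<close> times the integrable
  \<open>l *\<^sub>R g\<close>.\<close>

lemma integrable_likelihood_T_scaleR: "integrable M (\<lambda>\<theta>. (l \<theta> * T \<theta>) *\<^sub>R g \<theta>)"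
proof -
  have meas: "(\<lambda>\<theta>. ((real n + T \<theta>) * l \<theta>) *\<^sub>R g \<theta>) \<in> borel_measurable M"
    using integrable_l T_measurable g by measurable
  have "AE \<theta> in M. norm (((real n + T \<theta>) * l \<theta>) *\<^sub>R g \<theta>) \<le> norm (G \<theta>)"
    using tilt_derivative_dominated by eventually_elim simp
  with G meas have "integrable M (\<lambda>\<theta>. ((real n + T \<theta>) * l \<theta>) *\<^sub>R g \<theta>)"
    by (rule Bochner_Integration.integrable_bound)
  then have "integrable M (\<lambda>\<theta>. ((real n + T \<theta>) * l \<theta>) *\<^sub>R g \<theta> - real n *\<^sub>R (l \<theta> *\<^sub>R g \<theta>))"
    by (intro Bochner_Integration.integrable_diff integrable_scaleR_right integrable_likelihood_scaleR)
  then show ?thesis by (simp add: algebra_simps)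
qed

lemma tilt_moment_has_derivative:
  "((\<lambda>\<alpha>. \<integral>\<theta>. tilt \<alpha> \<theta> *\<^sub>R g \<theta> \<partial>M) has_vector_derivative (\<integral>\<theta>. ((real n + T \<theta>) * l \<theta>) *\<^sub>R g \<theta> \<partial>M))
     (at 1 within {1..})"
proof (rule right_derivative_integral_dominated[OF _ G \<delta>0])
  show "integrable M (\<lambda>\<theta>. tilt \<alpha> \<theta> *\<^sub>R g \<theta>)" if "1 \<le> \<alpha>" for \<alpha>
    using that g integrable_likelihood_scaleR by (rule integrable_tilt_scaleR)
  show "(\<lambda>\<theta>. ((real n + T \<theta>) * l \<theta>) *\<^sub>R g \<theta>) \<in> borel_measurable M"
    using integrable_l T_measurable g by measurable
  show "AE \<theta> in M. ((\<lambda>\<alpha>. tilt \<alpha> \<theta> *\<^sub>R g \<theta>) has_vector_derivative ((real n + T \<theta>) * l \<theta>) *\<^sub>R g \<theta>)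
      (at 1 within {1..})"
    by (intro AE_I2) (auto intro!: derivative_eq_intros tilt_has_derivative)
  fix \<delta> :: real assume "0 < \<delta>" "\<delta> \<le> \<delta>0"
  from dominated[OF this]
  show "AE \<theta> in M. norm ((tilt (1 + \<delta>) \<theta> *\<^sub>R g \<theta> - tilt 1 \<theta> *\<^sub>R g \<theta>) /\<^sub>R \<delta>) \<le> G \<theta>"
    by eventually_elim (simp add: scaleR_diff_left[symmetric] divide_inverse mult.commute)
qed

lemma posterior_expectation_has_derivative:
  assumes T: "integrable (posterior_of M l) T"
  shows "((\<lambda>\<alpha>. \<integral>\<theta>. g \<theta> \<partial>posterior_of M (tilt \<alpha>)) has_vector_derivative
           (\<integral>\<theta>. T \<theta> *\<^sub>R g \<theta> \<partial>posterior_of M l) -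
           (\<integral>\<theta>. T \<theta> \<partial>posterior_of M l) *\<^sub>R (\<integral>\<theta>. g \<theta> \<partial>posterior_of M l)) (at 1 within {1..})"
proof -
  define Z where "Z \<alpha> = (\<integral>\<theta>. tilt \<alpha> \<theta> \<partial>M)" for \<alpha>
  define N where "N \<alpha> = (\<integral>\<theta>. tilt \<alpha> \<theta> *\<^sub>R g \<theta> \<partial>M)" for \<alpha>
  define t where "t = (\<integral>\<theta>. l \<theta> * T \<theta> \<partial>M)"
  define u where "u = (\<integral>\<theta>. (l \<theta> * T \<theta>) *\<^sub>R g \<theta> \<partial>M)"
  have Z1: "0 < Z 1" using well_defined by (simp add: Z_def bayes_well_defined_def)
  have lT: "integrable M (\<lambda>\<theta>. l \<theta> * T \<theta>)"
    using T integrable_posterior_of_iff[OF well_defined l_nonneg T_measurable] by simp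
  have "(\<integral>\<theta>. (real n + T \<theta>) * l \<theta> \<partial>M) = (\<integral>\<theta>. real n * l \<theta> + l \<theta> * T \<theta> \<partial>M)"
    by (simp add: algebra_simps)
  also have "\<dots> = real n * Z 1 + t"
    using lT integrable_l by (simp add: Z_def t_def)
  finally have dZ: "(Z has_real_derivative real n * Z 1 + t) (at 1 within {1..})"
    using tilt_integral_has_derivative[OF lT] by (simp add: Z_def[abs_def])
  have "(\<integral>\<theta>. ((real n + T \<theta>) * l \<theta>) *\<^sub>R g \<theta> \<partial>M)
      = (\<integral>\<theta>. real n *\<^sub>R (l \<theta> *\<^sub>R g \<theta>) + (l \<theta> * T \<theta>) *\<^sub>R g \<theta> \<partial>M)"
    by (simp add: algebra_simps)
  also have "\<dots> = (\<integral>\<theta>. real n *\<^sub>R (l \<theta> *\<^sub>R g \<theta>) \<partial>M) + u"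
    unfolding u_def
    by (intro Bochner_Integration.integral_add integrable_scaleR_right
        integrable_likelihood_scaleR integrable_likelihood_T_scaleR)
  also have "(\<integral>\<theta>. real n *\<^sub>R (l \<theta> *\<^sub>R g \<theta>) \<partial>M) = real n *\<^sub>R N 1"
    by (simp only: integral_scaleR_right N_def tilt_1)
  finally have dN: "(N has_vector_derivative real n *\<^sub>R N 1 + u) (at 1 within {1..})"
    using tilt_moment_has_derivative by (simp add: N_def[abs_def])
  have "((\<lambda>\<alpha>. 1 / Z \<alpha>) has_real_derivative - (real n * Z 1 + t) / (Z 1)\<^sup>2) (at 1 within {1..})"
    using Z1 by (auto intro!: derivative_eq_intros dZ simp: power2_eq_square)
  from has_vector_derivative_scaleR[OF this dN]
  have "((\<lambda>\<alpha>. (1 / Z \<alpha>) *\<^sub>R N \<alpha>) has_vector_derivative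
      (1 / Z 1) *\<^sub>R (real n *\<^sub>R N 1 + u) + (- (real n * Z 1 + t) / (Z 1)\<^sup>2) *\<^sub>R N 1) (at 1 within {1..})" .
  \<comment> \<open>The two terms with \<open>n\<close> cancel here, since both equal
    \<open>(n / Z 1) *\<^sub>R N 1\<close> up to sign.\<close>
  moreover have "(1 / Z 1) *\<^sub>R (real n *\<^sub>R N 1 + u) + (- (real n * Z 1 + t) / (Z 1)\<^sup>2) *\<^sub>R N 1
      = (1 / Z 1) *\<^sub>R u - (t / Z 1) *\<^sub>R ((1 / Z 1) *\<^sub>R N 1)"
  proof -
    have "- (real n * Z 1 + t) / (Z 1)\<^sup>2 = - (real n / Z 1) - t / Z 1 * (1 / Z 1)"
      using Z1 by (simp add: field_simps power2_eq_square)
    then show ?thesis by (simp add: scaleR_add_right scaleR_diff_left)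
  qed
  moreover have "(\<integral>\<theta>. T \<theta> \<partial>posterior_of M l) = t / Z 1"
    using integral_posterior_of[OF well_defined l_nonneg T_measurable] by (simp add: Z_def t_def)
  moreover have "(\<integral>\<theta>. g \<theta> \<partial>posterior_of M l) = (1 / Z 1) *\<^sub>R N 1"
    using integral_posterior_of[OF well_defined l_nonneg g] by (simp add: Z_def N_def)
  moreover have "(\<integral>\<theta>. T \<theta> *\<^sub>R g \<theta> \<partial>posterior_of M l) = (1 / Z 1) *\<^sub>R u"
    using integral_posterior_of[OF well_defined l_nonneg, of "\<lambda>\<theta>. T \<theta> *\<^sub>R g \<theta>"] T_measurable g
    by (simp add: Z_def u_def)
  ultimately have "((\<lambda>\<alpha>. (1 / Z \<alpha>) *\<^sub>R N \<alpha>) has_vector_derivative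
      (\<integral>\<theta>. T \<theta> *\<^sub>R g \<theta> \<partial>posterior_of M l) -
      (\<integral>\<theta>. T \<theta> \<partial>posterior_of M l) *\<^sub>R (\<integral>\<theta>. g \<theta> \<partial>posterior_of M l)) (at 1 within {1..})"
    by (simp only:)
  then show ?thesis
  \<comment> \<open>The posterior expectation is identified with the quotient of \<open>N\<close>
    and \<open>Z\<close> for \<alpha> \<ge> 1, which suffices for a derivative within
    \<open>{1..}\<close>.\<close>
  proof (rule has_vector_derivative_transform[rotated 2])
    fix \<alpha> :: real assume "\<alpha> \<in> {1..}"
    then show "(\<integral>\<theta>. g \<theta> \<partial>posterior_of M (tilt \<alpha>)) = (1 / Z \<alpha>) *\<^sub>R N \<alpha>"
      using integral_posterior_of[OF tilt_well_defined tilt_nonneg g] by (simp add: Z_def N_def)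
  qed simp
qed

end

end

section \<open>The power distortion\<close>

lemma distortion_deriv_power_distortion:
  assumes "1 \<le> \<alpha>" "y \<in> {0..1}"
  shows "distortion_deriv (power_distortion \<alpha>) y =
           (if y = 0 then if \<alpha> = 1 then 1 else 0 else \<alpha> * y powr (\<alpha> - 1))"
  unfolding distortion_deriv_def
  using power_distortion_has_deriv[OF assms] assms
  by (intro vector_derivative_within_closed_interval)
    (auto simp: has_real_derivative_iff_has_vector_derivative)

text \<open>At \<open>y = 0\<close> the derivative of the power distortion vanishes as soon as \<open>\<alpha> > 1\<close>.\<close>

lemma log_right_differentiable_power_distortion_pos:
  assumes y: "y \<in> {0..1}"
    and diff: "log_right_differentiable (\<lambda>\<alpha>. distortion_deriv (power_distortion \<alpha>) y) 1"
  shows "0 < y"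
proof -
  have "eventually (\<lambda>\<alpha>. 1 < \<alpha> \<and> 0 < distortion_deriv (power_distortion \<alpha>) y) (at_right 1)"
    using diff eventually_at_right_less[of "1::real"]
    by (auto simp: log_right_differentiable_def eventually_conj_iff)
  then obtain \<alpha> where "1 < \<alpha>" "0 < distortion_deriv (power_distortion \<alpha>) y"
    by (auto dest!: eventually_happens simp: trivial_limit_at_right_real)
  then show ?thesis
    using y distortion_deriv_power_distortion[of \<alpha> y] by (auto split: if_splits)
qed

text \<open>For positive \<open>F\<close> the power \<open>F powr (\<alpha> - 1)\<close> is
  \<open>exp ((\<alpha> - 1) * ln F)\<close>, and the product of exponentials collects into one. At
  \<open>F = 0\<close> this breaks down: \<open>ln 0 = 0\<close> would give the value 1.\<close>

lemma distorted_likelihood_power_distortion: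
  assumes \<alpha>: "1 \<le> \<alpha>" and F: "\<And>i. i \<in> {1..n} \<Longrightarrow> 0 < cond_cdf f \<theta> (x i) \<and> cond_cdf f \<theta> (x i) \<le> 1"
  shows "distorted_likelihood (power_distortion \<alpha>) f n x \<theta> =
           \<alpha> ^ n * exp ((\<alpha> - 1) * (\<Sum>i=1..n. ln (cond_cdf f \<theta> (x i)))) * likelihood f n x \<theta>"
proof -
  have "distorted_likelihood (power_distortion \<alpha>) f n x \<theta> =
      (\<Prod>i=1..n. \<alpha> * exp ((\<alpha> - 1) * ln (cond_cdf f \<theta> (x i))) * f \<theta> (x i))"
    unfolding distorted_likelihood_def
  proof (rule prod.cong[OF refl])
    fix i assume "i \<in> {1..n}"
    from F[OF this] distortion_deriv_power_distortion[OF \<alpha>, of "cond_cdf f \<theta> (x i)"]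
    show "f \<theta> (x i) * distortion_deriv (power_distortion \<alpha>) (cond_cdf f \<theta> (x i)) =
        \<alpha> * exp ((\<alpha> - 1) * ln (cond_cdf f \<theta> (x i))) * f \<theta> (x i)"
      by (simp add: powr_def)
  qed
  then show ?thesis
    by (simp add: prod.distrib exp_sum sum_distrib_left likelihood_def)
qed

section \<open>Measurability in the Bayesian model\<close>

context
  fixes \<Theta> :: "(real ^ 'k) set" and prior :: "(real ^ 'k) measure"
    and f :: "real ^ 'k \<Rightarrow> real ^ 'd \<Rightarrow> real"
  assumes model: "bayes_model \<Theta> prior f"
begin

lemma space_prior: "space prior = \<Theta>"
  using model sets_eq_imp_space_eq[of prior "restrict_space borel \<Theta>"]
  by (simp add: bayes_model_def space_restrict_space)

lemma density_joint_measurable: "(\<lambda>(\<theta>, y). f \<theta> y) \<in> borel_measurable (prior \<Otimes>\<^sub>M lborel)"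
  using model by (simp add: bayes_model_def)

lemma density_measurable_param: "(\<lambda>\<theta>. f \<theta> y) \<in> borel_measurable prior"
  using measurable_compose[OF measurable_Pair2'[of y lborel prior] density_joint_measurable] by simp

lemma density_measurable_sample: "\<theta> \<in> \<Theta> \<Longrightarrow> f \<theta> \<in> borel_measurable lborel"
  using measurable_compose[OF measurable_Pair1'[of \<theta> prior lborel] density_joint_measurable]
  by (simp add: space_prior)

lemma cond_cdf_bounds: "\<theta> \<in> \<Theta> \<Longrightarrow> cond_cdf f \<theta> y \<in> {0..1}"
  using model by (auto simp: bayes_model_def cond_cdf_def intro: prob_space.prob_le_1)

text \<open>The distribution function is a partial integral of the jointly measurable density, hence
  measurable in the remaining variable \<theta>.\<close>

lemma cond_cdf_measurable: "(\<lambda>\<theta>. cond_cdf f \<theta> y) \<in> borel_measurable prior"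
proof -
  note [measurable] = density_joint_measurable
  have "(\<lambda>\<theta>. enn2real (\<integral>\<^sup>+z. ennreal (f \<theta> z) * indicator {..y} z \<partial>lborel)) \<in> borel_measurable prior"
    by measurable
  also have "?this \<longleftrightarrow> (\<lambda>\<theta>. cond_cdf f \<theta> y) \<in> borel_measurable prior"
  proof (rule measurable_cong)
    fix \<theta> assume "\<theta> \<in> space prior"
    then show "enn2real (\<integral>\<^sup>+z. ennreal (f \<theta> z) * indicator {..y} z \<partial>lborel) = cond_cdf f \<theta> y"
      using density_measurable_sample[of \<theta>]
      by (simp add: cond_cdf_def cond_law_def measure_def emeasure_density space_prior)
  qed
  finally show ?thesis .
qed

end

theorem proposition1:
  fixes \<Theta> :: "(real ^ 'k) set"
    and prior :: "(real ^ 'k) measure"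
    and f :: "real ^ 'k \<Rightarrow> real ^ 'd \<Rightarrow> real"
    and n :: nat
    and x :: "nat \<Rightarrow> real ^ 'd"
    and g :: "real ^ 'k \<Rightarrow> real ^ 's"
    and G :: "real ^ 'k \<Rightarrow> real"
    and \<delta>0 :: real
  defines "L \<equiv> \<lambda>\<alpha>. distorted_likelihood (power_distortion \<alpha>) f n x"
    and "T \<equiv> \<lambda>\<theta>. \<Sum>i=1..n. ln (cond_cdf f \<theta> (x i))"
    and "post \<equiv> posterior_of prior (likelihood f n x)"
  assumes model: "bayes_model \<Theta> prior f"
    and sample: "1 \<le> n"
    and bayes: "bayes_well_defined prior (likelihood f n x)"
    and log_diff: "AE \<theta> in prior. \<forall>i\<in>{1..n}.
          log_right_differentiable (\<lambda>\<alpha>. distortion_deriv (power_distortion \<alpha>) (cond_cdf f \<theta> (x i))) 1"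
    and \<delta>0: "0 < \<delta>0"
    and g: "g \<in> borel_measurable prior"
    and G: "integrable prior G"
    and dominated: "\<And>\<delta>. 0 < \<delta> \<Longrightarrow> \<delta> \<le> \<delta>0 \<Longrightarrow>
          AE \<theta> in prior. norm (((L (1 + \<delta>) \<theta> - L 1 \<theta>) / \<delta>) *\<^sub>R g \<theta>) \<le> G \<theta>"
    and T_integrable: "integrable post T"
  shows "(\<forall>\<alpha>\<ge>1. prob_space (posterior_of prior (L \<alpha>)) \<and> integrable (posterior_of prior (L \<alpha>)) g) \<and>
         integrable post (\<lambda>\<theta>. T \<theta> *\<^sub>R g \<theta>) \<and>
         (\<lambda>\<alpha>. distorted_expectation (power_distortion \<alpha>) prior f n x g) differentiable (at 1 within {1..}) \<and>
         local_sensitivity power_distortion 1 prior f n x g = vec_covariance post g T"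
proof -
  let ?l = "likelihood f n x"
  have F_meas: "(\<lambda>\<theta>. cond_cdf f \<theta> (x i)) \<in> borel_measurable prior" for i
    using model by (rule cond_cdf_measurable)
  have F01: "AE \<theta> in prior. \<forall>i. cond_cdf f \<theta> (x i) \<in> {0..1}"
    using cond_cdf_bounds[OF model] by (intro AE_I2) (auto simp: space_prior[OF model])
  \<comment> \<open>Log-differentiability enters as strict positivity of the distribution function
    at all sample points.\<close>
  have F: "AE \<theta> in prior. \<forall>i\<in>{1..n}. 0 < cond_cdf f \<theta> (x i) \<and> cond_cdf f \<theta> (x i) \<le> 1"
    using F01 log_diff
    by eventually_elim (auto intro: log_right_differentiable_power_distortion_pos)
  interpret tilted_likelihood prior ?l T n
  proof
    show "bayes_well_defined prior ?l" by (rule bayes)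
    show "AE \<theta> in prior. 0 \<le> ?l \<theta>"
      using model by (intro AE_I2) (auto simp: space_prior[OF model] bayes_model_def likelihood_def
          intro!: prod_nonneg)
    show "T \<in> borel_measurable prior" using F_meas unfolding T_def by measurable
    show "AE \<theta> in prior. T \<theta> \<le> 0"
      using F by eventually_elim (auto simp: T_def intro!: sum_nonpos)
  qed
  have L_tilt: "AE \<theta> in prior. L \<alpha> \<theta> = tilt \<alpha> \<theta>" if "1 \<le> \<alpha>" for \<alpha>
    using F
    by eventually_elim
      (simp only: L_def tilt_def, simp only: T_def, rule distorted_likelihood_power_distortion[OF that], blast)
  \<comment> \<open>Almost sure equality with \<open>tilt\<close> does not make
    \<open>L \<alpha>\<close> measurable, since \<open>prior\<close> may be incomplete. The explicit
    formula, including the value at \<open>F = 0\<close>, does.\<close>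
  have deriv_meas: "(\<lambda>\<theta>. distortion_deriv (power_distortion \<alpha>) (cond_cdf f \<theta> (x i))) \<in> borel_measurable prior"
    if "1 \<le> \<alpha>" for \<alpha> i
  proof -
    have "(\<lambda>\<theta>. if cond_cdf f \<theta> (x i) = 0 then if \<alpha> = 1 then 1 else 0
        else \<alpha> * cond_cdf f \<theta> (x i) powr (\<alpha> - 1)) \<in> borel_measurable prior"
      using F_meas[of i] by measurable
    also have "?this \<longleftrightarrow> ?thesis"
      using that cond_cdf_bounds[OF model]
      by (intro measurable_cong) (auto simp: space_prior[OF model] distortion_deriv_power_distortion)
    finally show ?thesis .
  qed
  have L_meas: "L \<alpha> \<in> borel_measurable prior" if "1 \<le> \<alpha>" for \<alpha>
    unfolding L_def distorted_likelihood_def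
    by (intro borel_measurable_prod borel_measurable_times density_measurable_param[OF model] deriv_meas that)
  have post_tilt: "posterior_of prior (L \<alpha>) = posterior_of prior (tilt \<alpha>)" if "1 \<le> \<alpha>" for \<alpha>
    using that by (intro posterior_of_cong L_meas tilt_measurable L_tilt)
  have dom: "AE \<theta> in prior. norm (((tilt (1 + \<delta>) \<theta> - tilt 1 \<theta>) / \<delta>) *\<^sub>R g \<theta>) \<le> G \<theta>"
    if "0 < \<delta>" "\<delta> \<le> \<delta>0" for \<delta>
  proof -
    have "AE \<theta> in prior. L (1 + \<delta>) \<theta> = tilt (1 + \<delta>) \<theta>" "AE \<theta> in prior. L 1 \<theta> = tilt 1 \<theta>"
      using that by (intro L_tilt; simp)+
    with dominated[OF that] show ?thesis by eventually_elim simp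
  qed
  note tilted = sample \<delta>0 g G dom
  have lg: "integrable prior (\<lambda>\<theta>. ?l \<theta> *\<^sub>R g \<theta>)"
    using tilted by (rule integrable_likelihood_scaleR)
  have prob: "prob_space (posterior_of prior (L \<alpha>)) \<and> integrable (posterior_of prior (L \<alpha>)) g" if "1 \<le> \<alpha>" for \<alpha>
  proof -
    have nn: "AE \<theta> in prior. 0 \<le> tilt \<alpha> \<theta>" using that by (intro tilt_nonneg) simp
    show ?thesis
      unfolding post_tilt[OF that] integrable_posterior_of_iff[OF tilt_well_defined[OF that] nn g]
      using prob_space_posterior_of[OF tilt_well_defined[OF that] nn] integrable_tilt_scaleR[OF that g lg]
      by blast
  qed
  \<comment> \<open>At \<alpha> = 1 the tilting factor is 1, so the distorted posterior is the
    ordinary one.\<close>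
  have post1: "post = posterior_of prior (L 1)" by (simp add: post_def post_tilt)
  have "(\<lambda>\<theta>. T \<theta> *\<^sub>R g \<theta>) \<in> borel_measurable prior" using T_measurable g by measurable
  from integrable_posterior_of_iff[OF well_defined l_nonneg this]
  have Tg: "integrable post (\<lambda>\<theta>. T \<theta> *\<^sub>R g \<theta>)"
    using integrable_likelihood_T_scaleR[OF tilted] by (simp add: post_def)
  interpret post: prob_space post using prob[of 1] post1 by simp
  have cov: "vec_covariance post g T = (\<integral>\<theta>. T \<theta> *\<^sub>R g \<theta> \<partial>post) - (\<integral>\<theta>. T \<theta> \<partial>post) *\<^sub>R (\<integral>\<theta>. g \<theta> \<partial>post)"
    using prob[of 1] post1 T_integrable Tg by (intro post.vec_covariance_eq) auto
  have "((\<lambda>\<alpha>. \<integral>\<theta>. g \<theta> \<partial>posterior_of prior (tilt \<alpha>)) has_vector_derivative vec_covariance post g T)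
      (at 1 within {1..})"
    unfolding cov using tilted T_integrable unfolding post_def
    by (rule posterior_expectation_has_derivative)
  then have deriv: "((\<lambda>\<alpha>. distorted_expectation (power_distortion \<alpha>) prior f n x g) has_vector_derivative
      vec_covariance post g T) (at 1 within {1..})"
    by (rule has_vector_derivative_transform[rotated 2])
      (auto simp: distorted_expectation_def post_tilt[unfolded L_def])
  \<comment> \<open>Nontriviality of the filter makes the right derivative unique, so that
    \<open>vector_derivative\<close> returns it.\<close>
  have "at (1::real) within {1..} \<noteq> bot" by (simp add: at_within_Ici_at_right)
  then have "local_sensitivity power_distortion 1 prior f n x g = vec_covariance post g T"
    unfolding local_sensitivity_def using deriv by (rule vector_derivative_within)
  moreover have "(\<lambda>\<alpha>. distorted_expectation (power_distortion \<alpha>) prior f n x g) differentiable (at 1 within {1..})"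
    using deriv unfolding has_vector_derivative_def by (rule differentiableI)
  ultimately show ?thesis using prob Tg by blast
qed

end
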